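(* For every matrix $M\in\mathbb{H}^{n\times n}$, $\mathrm{Sdet}(M)=\prod_{i=1}^{n}|\lambda_i|$, where $\lambda_1,\dots,\lambda_n$ are the eigenvalues of $M$.
   Context: $\mathbb{H}$ is the skew-field of real quaternions $q=a+ib+jc+kd$ with $a,b,c,d\in\mathbb{R}$, $i^2=j^2=k^2=ijk=-1$, and norm $|q|=\sqrt{a^2+b^2+c^2+d^2}$. Every $M\in\mathbb{H}^{n\times n}$ is uniquely written $M=M_1+jM_2$ with $M_1,M_2\in\mathbb{C}^{n\times n}$ (where $\mathbb{C}=\mathbb{R}+i\mathbb{R}\subset\mathbb{H}$), and its complexification is the complex $2n\times 2n$ matrix $\mathcal{Z}[M]=\begin{pmatrix} M_1 & -M_2^*\\ M_2 & M_1^*\end{pmatrix}$, where $*$ is entrywise complex conjugation. The determinant $\det\mathcal{Z}[M]$ (the $q$-determinant) is real and nonnegative, and the Study determinant is normalized by $\mathrm{Sdet}[M]=\left(\det \mathcal{Z}[M]\right)^{1/2}\ge 0$. Eigenvalues: every $M\in\mathbb{H}^{n\times n}$ is similar over $\mathbb{H}$ (i.e. via $S^{-1}MS$ with $S\in\mathbb{H}^{n\times n}$ invertible) to a complex Jordan matrix $J\in\mathbb{C}^{n\times n}$. The eigenvalues $\lambda_1,\dots,\lambda_n\in\mathbb{C}$ of $M$ are the diagonal entries of $J$ (listed with multiplicity). They are determined up to order and up to replacing individual $\lambda_i$ by their complex conjugates; the spectrum of $\mathcal{Z}[M]$, with multiplicity, is $\{\lambda_1,\lambda_1^*,\dots,\lambda_n,\lambda_n^*\}$.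 *)

theory Defs
  imports Complex_Main "Jordan_Normal_Form.Jordan_Normal_Form"
begin

text \<open>\<^term>\<open>Quat a b c d\<close> stands for $a + ib + jc + kd$.\<close>

datatype quat = Quat (qre: real) (qi: real) (qj: real) (qk: real)

lemma quat_eq_iff:
  "p = q \<longleftrightarrow> qre p = qre q \<and> qi p = qi q \<and> qj p = qj q \<and> qk p = qk q"
  by (cases p; cases q) simp

instantiation quat :: division_ring
begin

definition zero_quat :: quat where "0 = Quat 0 0 0 0"

definition one_quat :: quat where "1 = Quat 1 0 0 0"

definition uminus_quat :: "quat \<Rightarrow> quat" where
  "- q = Quat (- qre q) (- qi q) (- qj q) (- qk q)"

definition plus_quat :: "quat \<Rightarrow> quat \<Rightarrow> quat" where
  "p + q = Quat (qre p + qre q) (qi p + qi q) (qj p + qj q) (qk p + qk q)"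

definition minus_quat :: "quat \<Rightarrow> quat \<Rightarrow> quat" where
  "p - q = Quat (qre p - qre q) (qi p - qi q) (qj p - qj q) (qk p - qk q)"

definition times_quat :: "quat \<Rightarrow> quat \<Rightarrow> quat" where
  "p * q = Quat
     (qre p * qre q - qi p * qi q - qj p * qj q - qk p * qk q)
     (qre p * qi q + qi p * qre q + qj p * qk q - qk p * qj q)
     (qre p * qj q - qi p * qk q + qj p * qre q + qk p * qi q)
     (qre p * qk q + qi p * qj q - qj p * qi q + qk p * qre q)"

definition inverse_quat :: "quat \<Rightarrow> quat" where
  "inverse q = (let s = (qre q)\<^sup>2 + (qi q)\<^sup>2 + (qj q)\<^sup>2 + (qk q)\<^sup>2
     in Quat (qre q / s) (- qi q / s) (- qj q / s) (- qk q / s))"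

definition divide_quat :: "quat \<Rightarrow> quat \<Rightarrow> quat" where
  "divide_quat p q = p * inverse q"

instance
proof
  fix a b c :: quat
  show "a * b * c = a * (b * c)"
    by (simp add: times_quat_def algebra_simps)
  show "(a + b) * c = a * c + b * c" "a * (b + c) = a * b + a * c"
    by (simp_all add: times_quat_def plus_quat_def algebra_simps)
  show "1 * a = a" "a * 1 = a"
    by (simp_all add: times_quat_def one_quat_def)
  show "a + b + c = a + (b + c)" "a + b = b + a"
    by (simp_all add: plus_quat_def)
  show "0 + a = a" "- a + a = 0"
    by (simp_all add: plus_quat_def zero_quat_def uminus_quat_def)
  show "a - b = a + - b"
    by (simp add: plus_quat_def minus_quat_def uminus_quat_def)
  show "(0 :: quat) \<noteq> 1"
    by (simp add: zero_quat_def one_quat_def)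
  show "a div b = a * inverse b"
    by (fact divide_quat_def)
  show "inverse (0 :: quat) = 0"
    by (simp add: inverse_quat_def zero_quat_def)
  assume "a \<noteq> 0"
  then have s: "(qre a)\<^sup>2 + (qi a)\<^sup>2 + (qj a)\<^sup>2 + (qk a)\<^sup>2 \<noteq> 0"
    by (simp add: quat_eq_iff zero_quat_def add_nonneg_eq_0_iff)
  define t where "t = inverse ((qre a)\<^sup>2 + (qi a)\<^sup>2 + (qj a)\<^sup>2 + (qk a)\<^sup>2)"
  have inv: "inverse a = Quat (qre a * t) (- qi a * t) (- qj a * t) (- qk a * t)"
    by (simp only: inverse_quat_def t_def divide_inverse Let_def)
  have t: "((qre a)\<^sup>2 + (qi a)\<^sup>2 + (qj a)\<^sup>2 + (qk a)\<^sup>2) * t = 1"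
    using s by (simp add: t_def)
  have t': "qre a * qre a * t + qi a * qi a * t + qj a * qj a * t + qk a * qk a * t = 1"
    using t by (simp only: power2_eq_square distrib_right)
  show "inverse a * a = 1" "a * inverse a = 1"
    unfolding inv times_quat_def one_quat_def quat.inject quat.sel
    by (intro conjI; (rule trans[OF _ t'])?; simp add: mult_ac)+
qed

end

abbreviation (input) quat_I :: quat where "quat_I \<equiv> Quat 0 1 0 0"
abbreviation (input) quat_J :: quat where "quat_J \<equiv> Quat 0 0 1 0"
abbreviation (input) quat_K :: quat where "quat_K \<equiv> Quat 0 0 0 1"

lemma quat_units:
  "quat_I * quat_I = - 1" "quat_J * quat_J = - 1" "quat_K * quat_K = - 1"
  "quat_I * quat_J * quat_K = - 1"
  by (simp_all add: times_quat_def one_quat_def uminus_quat_def)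

definition quat_of_complex :: "complex \<Rightarrow> quat" where
  "quat_of_complex z = Quat (Re z) (Im z) 0 0"

text \<open>The components of $q = q_1 + j q_2$ with $q_1, q_2$ complex. The sign in the second
  one comes from $j(x + iy) = jx - ky$.\<close>

definition quat_fst :: "quat \<Rightarrow> complex" where
  "quat_fst q = Complex (qre q) (qi q)"

definition quat_snd :: "quat \<Rightarrow> complex" where
  "quat_snd q = Complex (qj q) (- qk q)"

lemma quat_decomp_unique:
  "q = quat_of_complex z + quat_J * quat_of_complex w \<longleftrightarrow> z = quat_fst q \<and> w = quat_snd q"
proof -
  have "quat_of_complex z + quat_J * quat_of_complex w = Quat (Re z) (Im z) (Re w) (- Im w)"
    by (simp add: quat_of_complex_def times_quat_def plus_quat_def)
  then show ?thesis
    by (cases q; cases z; cases w) (auto simp: quat_fst_def quat_snd_def)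
qed

definition complexification :: "quat mat \<Rightarrow> complex mat" where
  "complexification M =
     (let M1 = map_mat quat_fst M; M2 = map_mat quat_snd M
      in four_block_mat M1 (- map_mat cnj M2) M2 (map_mat cnj M1))"

text \<open>Complex-valued, so that no part of the determinant is discarded; for a nonnegative
  real argument \<^const>\<open>csqrt\<close> is the nonnegative real square root.\<close>

definition Sdet :: "quat mat \<Rightarrow> complex" where
  "Sdet M = csqrt (det (complexification M))"

text \<open>\<^term>\<open>ls\<close> is a list of eigenvalues of \<^term>\<open>M\<close>: the diagonal, with multiplicity, of a complex
  Jordan matrix to which \<^term>\<open>M\<close> is similar over the quaternions. It is a relation because the
  list is unique only up to order and up to conjugating entries.\<close>

definition quat_eigenvalues :: "quat mat \<Rightarrow> complex list \<Rightarrow> bool" where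
  "quat_eigenvalues M ls \<longleftrightarrow>
     (\<exists>n_as :: (nat \<times> complex) list.
        0 \<notin> fst ` set n_as \<and>
        similar_mat M (map_mat quat_of_complex (jordan_matrix n_as)) \<and>
        ls = diag_mat (jordan_matrix n_as))"

lemma quat_eigenvalues_length:
  assumes "M \<in> carrier_mat n n" "quat_eigenvalues M ls"
  shows "length ls = n"
proof -
  obtain n_as :: "(nat \<times> complex) list"
    where sim: "similar_mat M (map_mat quat_of_complex (jordan_matrix n_as))"
      and ls: "ls = diag_mat (jordan_matrix n_as)"
    using assms(2) unfolding quat_eigenvalues_def by blast
  obtain m where "M \<in> carrier_mat m m"
    and "map_mat quat_of_complex (jordan_matrix n_as) \<in> carrier_mat m m"
    using similar_matD[OF sim] by blast
  then have "dim_row (jordan_matrix n_as) = n"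
    using assms(1) by (metis carrier_matD(1) index_map_mat(2))
  then show ?thesis
    unfolding ls diag_mat_def by (simp only: length_map length_upt diff_zero)
qed

end

theory Submission
  imports Defs
begin

text \<open>Complexification is an algebra homomorphism, so the determinant of the complexification is a
  similarity invariant over the quaternions. On a complex matrix \<open>J\<close> it is block diagonal with
  blocks \<open>J\<close> and its entrywise conjugate, so the determinant is \<open>\<bar>det J\<bar>\<^sup>2\<close>, which for a triangular
  \<open>J\<close> is the squared product of the absolute values of the diagonal entries.\<close>

text \<open>Moving \<open>j\<close> to the left past a complex \<open>z\<close> conjugates it,
  \<open>z j = j (cnj z)\<close>, and \<open>j j = -1\<close>. Expanding
  \<open>(p1 + j p2) (q1 + j q2)\<close> with these rules gives both this formula and the
  next.\<close>

lemma quat_fst_mult: "quat_fst (p * q) = quat_fst p * quat_fst q - cnj (quat_snd p) * quat_snd q"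
  by (simp add: quat_fst_def quat_snd_def times_quat_def complex_eq_iff)

lemma quat_snd_mult: "quat_snd (p * q) = quat_snd p * quat_fst q + cnj (quat_fst p) * quat_snd q"
  by (simp add: quat_fst_def quat_snd_def times_quat_def complex_eq_iff)

lemma quat_fst_sum: "quat_fst (sum f A) = (\<Sum>x\<in>A. quat_fst (f x))"
  by (induction A rule: infinite_finite_induct)
    (simp_all add: quat_fst_def plus_quat_def zero_quat_def complex_eq_iff)

lemma quat_snd_sum: "quat_snd (sum f A) = (\<Sum>x\<in>A. quat_snd (f x))"
  by (induction A rule: infinite_finite_induct)
    (simp_all add: quat_snd_def plus_quat_def zero_quat_def complex_eq_iff)

lemma quat_fst_of_complex [simp]: "quat_fst (quat_of_complex z) = z"
  and quat_snd_of_complex [simp]: "quat_snd (quat_of_complex z) = 0"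
  by (simp_all add: quat_fst_def quat_snd_def quat_of_complex_def complex_eq_iff)

text \<open>Makes \<open>cnj\<close> commute with \<open>det\<close> and fix identity matrices, as
  needed for the conjugated block of a complex matrix.\<close>

interpretation cnj_hom: comm_ring_hom cnj
  by unfold_locales simp_all

lemma complexification_carrier [simp]:
  "M \<in> carrier_mat n m \<Longrightarrow> complexification M \<in> carrier_mat (n + n) (m + m)"
  by (auto simp: complexification_def Let_def)

text \<open>The left block column of the product is given by the formulas for
  \<open>quat_fst\<close> and \<open>quat_snd\<close> of a product, summed over the inner
  index.\<close>

lemma complexification_mult:
  assumes A: "A \<in> carrier_mat nr n" and B: "B \<in> carrier_mat n nc"
  shows "complexification (A * B) = complexification A * complexification B"
proof -
  let ?A1 = "map_mat quat_fst A" and ?A2 = "map_mat quat_snd A"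
  let ?B1 = "map_mat quat_fst B" and ?B2 = "map_mat quat_snd B"
  have "complexification A * complexification B =
    four_block_mat
      (?A1 * ?B1 + - map_mat cnj ?A2 * ?B2)
      (?A1 * - map_mat cnj ?B2 + - map_mat cnj ?A2 * map_mat cnj ?B1)
      (?A2 * ?B1 + map_mat cnj ?A1 * ?B2)
      (?A2 * - map_mat cnj ?B2 + map_mat cnj ?A1 * map_mat cnj ?B1)"
    unfolding complexification_def Let_def
    by (rule mult_four_block_mat) (use A B in auto)
  also have "?A1 * ?B1 + - map_mat cnj ?A2 * ?B2 = map_mat quat_fst (A * B)"
    using A B by (intro eq_matI)
      (auto simp: scalar_prod_def quat_fst_sum quat_fst_mult sum_subtractf sum_negf)
  \<comment> \<open>Up to sign, the right block column is the conjugate of the left one with its two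
    blocks swapped.\<close>
  also have "?A1 * - map_mat cnj ?B2 + - map_mat cnj ?A2 * map_mat cnj ?B1
      = - map_mat cnj (map_mat quat_snd (A * B))"
    using A B by (intro eq_matI)
      (auto simp: scalar_prod_def quat_snd_sum quat_snd_mult sum.distrib sum_negf)
  also have "?A2 * ?B1 + map_mat cnj ?A1 * ?B2 = map_mat quat_snd (A * B)"
    using A B by (intro eq_matI)
      (auto simp: scalar_prod_def quat_snd_sum quat_snd_mult sum.distrib)
  also have "?A2 * - map_mat cnj ?B2 + map_mat cnj ?A1 * map_mat cnj ?B1
      = map_mat cnj (map_mat quat_fst (A * B))"
    using A B by (intro eq_matI)
      (auto simp: scalar_prod_def quat_fst_sum quat_fst_mult sum_subtractf sum_negf)
  finally show ?thesis
    by (simp add: complexification_def Let_def)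
qed

lemma complexification_of_complex:
  assumes "J \<in> carrier_mat n n"
  shows "complexification (map_mat quat_of_complex J)
    = four_block_mat J (0\<^sub>m n n) (0\<^sub>m n n) (map_mat cnj J)"
  using assms by (intro eq_matI) (auto simp: complexification_def Let_def)

lemma complexification_one: "complexification (1\<^sub>m n) = 1\<^sub>m (n + n)"
proof -
  \<comment> \<open>The quaternionic identity has complex entries, so its off-diagonal blocks vanish
    and both diagonal blocks are identities.\<close>
  have "1\<^sub>m n = map_mat quat_of_complex (1\<^sub>m n)"
    by (intro eq_matI) (auto simp: quat_of_complex_def one_quat_def zero_quat_def)
  then show ?thesis
    by (simp add: complexification_of_complex[of _ n] cnj_hom.mat_hom_one)
qed

text \<open>A unital multiplicative map sends the inverse pair \<open>P\<close>, \<open>Q\<close> to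
  an inverse pair. This moves similarity from the skew field to complex matrices, where similar
  matrices have equal determinants.\<close>

lemma similar_mat_complexification:
  assumes "similar_mat A B"
  shows "similar_mat (complexification A) (complexification B)"
proof -
  obtain n P Q where carr: "{A, B, P, Q} \<subseteq> carrier_mat n n"
    and PQ: "P * Q = 1\<^sub>m n" "Q * P = 1\<^sub>m n" and AB: "A = P * B * Q"
    using similar_matD[OF assms] by blast
  then have P: "P \<in> carrier_mat n n" and B: "B \<in> carrier_mat n n" and Q: "Q \<in> carrier_mat n n"
    by auto
  show ?thesis
  proof (rule similar_matI)
    show "{complexification A, complexification B, complexification P, complexification Q}
        \<subseteq> carrier_mat (n + n) (n + n)"
      using carr by auto
    show "complexification P * complexification Q = 1\<^sub>m (n + n)"
      "complexification Q * complexification P = 1\<^sub>m (n + n)"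
      using PQ complexification_mult[OF P Q] complexification_mult[OF Q P]
      by (simp_all add: complexification_one)
    show "complexification A = complexification P * complexification B * complexification Q"
      using AB complexification_mult[OF mult_carrier_mat[OF P B] Q] complexification_mult[OF P B]
      by simp
  qed
qed

text \<open>The two diagonal blocks contribute \<open>z\<close> and \<open>cnj z\<close> with
  \<open>z = det J\<close>, and \<open>z * cnj z\<close> is the squared modulus.\<close>

lemma det_complexification_of_complex:
  assumes J: "J \<in> carrier_mat n n"
  shows "det (complexification (map_mat quat_of_complex J)) = complex_of_real ((cmod (det J))\<^sup>2)"
proof -
  have "det (complexification (map_mat quat_of_complex J)) = det J * det (map_mat cnj J)"
    unfolding complexification_of_complex[OF J]
    by (rule det_four_block_mat_upper_right_zero) (use J in auto)
  then show ?thesis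
    by (simp only: cnj_hom.hom_det complex_norm_square)
qed

theorem corollary6p2:
  fixes M :: "quat mat" and n :: nat and ls :: "complex list"
  assumes "M \<in> carrier_mat n n"
    and "quat_eigenvalues M ls"
  shows "Sdet M = complex_of_real (\<Prod>i<n. cmod (ls ! i))"
proof -
  obtain n_as :: "(nat \<times> complex) list"
    where sim: "similar_mat M (map_mat quat_of_complex (jordan_matrix n_as))"
      and ls: "ls = diag_mat (jordan_matrix n_as)"
    using assms(2) unfolding quat_eigenvalues_def by blast
  define J where "J = jordan_matrix n_as"
  have len: "length ls = n"
    using assms by (rule quat_eigenvalues_length)
  have dim: "J \<in> carrier_mat (sum_list (map fst n_as)) (sum_list (map fst n_as))"
    by (simp add: J_def)
  \<comment> \<open>The size of a Jordan matrix is the sum of its block sizes; it is also the length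
    of the diagonal, which is known to be \<open>n\<close>.\<close>
  then have "sum_list (map fst n_as) = n"
    using len by (simp add: ls J_def diag_mat_def)
  with dim have J: "J \<in> carrier_mat n n" and ut: "upper_triangular J"
    by (auto simp: J_def jordan_matrix_upper_triangular)
  have "det J = prod_list ls"
    using det_upper_triangular[OF ut J] by (simp add: ls J_def)
  also have "\<dots> = (\<Prod>i<n. ls ! i)"
    by (simp add: prod.list_conv_set_nth len atLeast0LessThan)
  finally have "cmod (det J) = (\<Prod>i<n. cmod (ls ! i))"
    by (simp add: prod_norm)
  moreover have "det (complexification M) = complex_of_real ((cmod (det J))\<^sup>2)"
    using det_similar[OF similar_mat_complexification[OF sim]] det_complexification_of_complex[OF J]
    by (simp add: J_def)
  \<comment> \<open>The product of moduli is nonnegative, so the root of its square is the product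
    itself. Deleting the two rules keeps the argument of \<open>csqrt\<close> a single embedded
    real, whose real and imaginary parts are immediate.\<close>
  ultimately show ?thesis
    by (simp add: Sdet_def csqrt_of_real_nonneg prod_nonneg del: of_real_power of_real_prod)
qed

end
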